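(* For any finite group $G$, any subgroup $A$ of $\operatorname{Aut}(G)$ and any positive integer $t$, $$\phi(G,t)=\sum_{[H]_A \in \mathcal C_A(G)}\mu_A(H,G)\,\Bigl|\bigcup_{a\in A}(H^a)^t\Bigr|,$$ where $\phi(G,t)$ is the number of $t$-tuples $(g_1,\dots,g_t)\in G^t$ such that $G=\langle g_1,\dots,g_t\rangle$.
   Context: The Möbius function of a finite poset $P$ is the map $\mu_P:P\times P\to\mathbb Z$ with $\mu_P(x,y)=0$ unless $x\leq y$, $\mu_P(x,x)=1$, and $\sum_{x\leq z\leq y}\mu_P(x,z)=0$ for $x<y$. For a finite group $G$ and $A\leq \operatorname{Aut}(G)$, let $[H]_A=\{H^a\mid a\in A\}$ for $H\leq G$, and let $\mathcal C_A(G)$ be the set of all $[H]_A$, $H\le G$, partially ordered by: $[H]_A\leq [K]_A$ if $H^a\leq K$ for some $a\in A$. Let $\mu_A$ be the Möbius function of the poset $\mathcal C_A(G)$ and write $\mu_A(H,K)=\mu_A([H]_A,[K]_A)$. Here $(H^a)^t\subseteq G^t$ denotes the $t$-fold Cartesian power of the subgroup $H^a$. *)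

theory Defs
  imports "HOL-Algebra.Bij" "HOL-Algebra.Generated_Groups"
begin

section \<open>The Moebius function of a finite poset\<close>

text \<open>
  The value outside the carrier is fixed to be \<open>0\<close>; this only makes the function unique
  as a total function.
\<close>

definition is_moebius :: "'a set \<Rightarrow> ('a \<times> 'a) set \<Rightarrow> ('a \<Rightarrow> 'a \<Rightarrow> int) \<Rightarrow> bool" where
  "is_moebius P r m \<longleftrightarrow>
     (\<forall>x y. x \<notin> P \<or> y \<notin> P \<longrightarrow> m x y = 0) \<and>
     (\<forall>x\<in>P. \<forall>y\<in>P. (x, y) \<notin> r \<longrightarrow> m x y = 0) \<and>
     (\<forall>x\<in>P. m x x = 1) \<and>
     (\<forall>x\<in>P. \<forall>y\<in>P. (x, y) \<in> r \<and> x \<noteq> y \<longrightarrow>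
        (\<Sum>z\<in>{z\<in>P. (x, z) \<in> r \<and> (z, y) \<in> r}. m x z) = 0)"

definition moebius :: "'a set \<Rightarrow> ('a \<times> 'a) set \<Rightarrow> 'a \<Rightarrow> 'a \<Rightarrow> int" where
  "moebius P r = (THE m. is_moebius P r m)"

lemma wf_strict_part:
  assumes "finite P" "partial_order_on P r"
  shows "wf {(z, y). (z, y) \<in> r \<and> z \<noteq> y}"
proof -
  have r: "r \<subseteq> P \<times> P" "trans r" "antisym r"
    using assms(2) by (auto simp: partial_order_on_def preorder_on_def)
  have eq: "{(z, y). (z, y) \<in> r \<and> z \<noteq> y} = r - Id" by auto
  have "finite (r - Id)"
    using finite_subset[OF r(1)] assms(1) by auto
  moreover have "acyclic (r - Id)"
    using r by (simp add: acyclic_irrefl trans_diff_Id irrefl_diff_Id)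
  ultimately show ?thesis unfolding eq by (rule finite_acyclic_wf)
qed

lemma interval_split:
  fixes f :: "'a \<Rightarrow> int"
  assumes "finite P" "partial_order_on P r" "y \<in> P" "(x, y) \<in> r"
  shows "(\<Sum>z\<in>{z\<in>P. (x, z) \<in> r \<and> (z, y) \<in> r}. f z) =
         f y + (\<Sum>z\<in>{z\<in>P. (x, z) \<in> r \<and> (z, y) \<in> r \<and> z \<noteq> y}. f z)"
proof -
  have "(y, y) \<in> r"
    using assms by (auto simp: partial_order_on_def preorder_on_def refl_on_def)
  then have "{z\<in>P. (x, z) \<in> r \<and> (z, y) \<in> r} =
             insert y {z\<in>P. (x, z) \<in> r \<and> (z, y) \<in> r \<and> z \<noteq> y}"
    using assms by auto
  then show ?thesis using assms(1) by simp
qed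

lemma is_moebius_unique:
  assumes fin: "finite P" and po: "partial_order_on P r"
    and m: "is_moebius P r m" and n: "is_moebius P r n"
  shows "m = n"
proof (intro ext)
  fix x y
  show "m x y = n x y"
  proof (induction y rule: wf_induct_rule[OF wf_strict_part[OF fin po]])
    case (1 y)
    show ?case
    proof (cases "x \<in> P \<and> y \<in> P \<and> (x, y) \<in> r \<and> x \<noteq> y")
      case True
      let ?I = "{z\<in>P. (x, z) \<in> r \<and> (z, y) \<in> r \<and> z \<noteq> y}"
      have "m x y + (\<Sum>z\<in>?I. m x z) = 0"
        using True m interval_split[OF fin po, of y x "m x"] by (simp add: is_moebius_def)
      moreover have "n x y + (\<Sum>z\<in>?I. n x z) = 0"
        using True n interval_split[OF fin po, of y x "n x"] by (simp add: is_moebius_def)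
      moreover have "(\<Sum>z\<in>?I. m x z) = (\<Sum>z\<in>?I. n x z)"
        by (rule sum.cong) (use 1 in auto)
      ultimately show ?thesis by simp
    next
      case False
      then consider "x \<notin> P \<or> y \<notin> P" | "x \<in> P" "y \<in> P" "(x, y) \<notin> r" | "x \<in> P" "x = y"
        by blast
      then show ?thesis
        by cases (use m n in \<open>simp_all add: is_moebius_def\<close>)
    qed
  qed
qed

lemma is_moebius_exists:
  assumes fin: "finite P" and po: "partial_order_on P r"
  shows "\<exists>m. is_moebius P r m"
proof -
  let ?R = "{(z, y). (z, y) \<in> r \<and> z \<noteq> y}"
  define F where "F = (\<lambda>x (f :: _ \<Rightarrow> int) y.
     if x \<notin> P \<or> y \<notin> P \<or> (x, y) \<notin> r then 0 else if x = y then 1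
     else - (\<Sum>z\<in>{z\<in>P. (x, z) \<in> r \<and> (z, y) \<in> r \<and> z \<noteq> y}. f z))"
  define m where "m = (\<lambda>x. wfrec ?R (F x))"
  have rec: "m x y = F x (m x) y" for x y
  proof -
    have "m x y = F x (cut (m x) ?R y) y"
      unfolding m_def by (rule wfrec[OF wf_strict_part[OF fin po]])
    also have "\<dots> = F x (m x) y"
      unfolding F_def by (auto simp: cut_def intro!: sum.cong)
    finally show ?thesis .
  qed
  have refl: "(x, x) \<in> r" if "x \<in> P" for x
    using that po by (auto simp: partial_order_on_def preorder_on_def refl_on_def)
  have "is_moebius P r m"
    unfolding is_moebius_def
  proof (intro conjI allI ballI impI)
    fix x y assume xy: "x \<in> P" "y \<in> P" "(x, y) \<in> r \<and> x \<noteq> y"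
    then show "(\<Sum>z\<in>{z\<in>P. (x, z) \<in> r \<and> (z, y) \<in> r}. m x z) = 0"
      using interval_split[OF fin po, of y x "m x"] rec[of x y] by (simp add: F_def)
  qed (subst rec; use refl in \<open>auto simp: F_def\<close>)+
  then show ?thesis by blast
qed

lemma is_moebius_moebius:
  assumes "finite P" "partial_order_on P r"
  shows "is_moebius P r (moebius P r)"
  unfolding moebius_def
  using is_moebius_exists[OF assms] is_moebius_unique[OF assms] by (metis theI)


section \<open>Subgroups up to a group of automorphisms\<close>

text \<open>
  \<open>A\<close> is meant to be a subgroup of \<open>AutoGroup G\<close>, and \<open>a ` H\<close> is the subgroup written \<open>H\<^sup>a\<close>.
\<close>

definition aut_class :: "('a \<Rightarrow> 'a) set \<Rightarrow> 'a set \<Rightarrow> 'a set set" where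
  "aut_class A H = {a ` H | a. a \<in> A}"

definition aut_classes :: "('a, 'b) monoid_scheme \<Rightarrow> ('a \<Rightarrow> 'a) set \<Rightarrow> 'a set set set" where
  "aut_classes G A = {aut_class A H | H. subgroup H G}"

definition aut_class_order ::
  "('a, 'b) monoid_scheme \<Rightarrow> ('a \<Rightarrow> 'a) set \<Rightarrow> ('a set set \<times> 'a set set) set" where
  "aut_class_order G A =
     {(aut_class A H, aut_class A K) | H K.
        subgroup H G \<and> subgroup K G \<and> (\<exists>a\<in>A. a ` H \<subseteq> K)}"

definition aut_moebius ::
  "('a, 'b) monoid_scheme \<Rightarrow> ('a \<Rightarrow> 'a) set \<Rightarrow> 'a set set \<Rightarrow> 'a set set \<Rightarrow> int" where
  "aut_moebius G A = moebius (aut_classes G A) (aut_class_order G A)"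

text \<open>\<open>t\<close>-tuples are extensional functions on \<open>{1..t}\<close>.\<close>

definition tuples :: "nat \<Rightarrow> 'a set \<Rightarrow> (nat \<Rightarrow> 'a) set" where
  "tuples t S = {1..t} \<rightarrow>\<^sub>E S"

definition num_generating_tuples :: "('a, 'b) monoid_scheme \<Rightarrow> nat \<Rightarrow> nat" where
  "num_generating_tuples G t =
     card {g \<in> tuples t (carrier G). generate G (g ` {1..t}) = carrier G}"

text \<open>
  For a class \<open>C = [H]\<close>, the union of all \<open>(H\<^sup>a)\<^sup>t\<close> can be written without choosing a
  representative of \<open>C\<close>:
\<close>

lemma Union_tuples_aut_class:
  "(\<Union>K\<in>aut_class A H. tuples t K) = (\<Union>a\<in>A. tuples t (a ` H))"
  by (auto simp: aut_class_def)

text \<open>The remaining facts show that the classes form a finite poset.\<close>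

context
  fixes G :: "('a, 'b) monoid_scheme" (structure) and A
  assumes grp: "group G" and fin: "finite (carrier G)" and A: "subgroup A (AutoGroup G)"
begin

lemma aut_auto: "a \<in> A \<Longrightarrow> a \<in> auto G"
  using subgroup.subset[OF A] by (auto simp: AutoGroup_def)

lemma aut_inj: "a \<in> A \<Longrightarrow> inj_on a (carrier G)"
  using aut_auto by (auto simp: auto_def Bij_def bij_betw_def)

lemma aut_image_carrier: "a \<in> A \<Longrightarrow> a ` carrier G = carrier G"
  using aut_auto by (auto simp: auto_def Bij_def bij_betw_def)

lemma aut_image_id: 
  "(\<lambda>x\<in>carrier G. x) \<in> A" "H \<subseteq> carrier G \<Longrightarrow> (\<lambda>x\<in>carrier G. x) ` H = H"
  using subgroup.one_closed[OF A] by (auto simp: AutoGroup_def BijGroup_def image_iff)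

lemma aut_image_compose:
  assumes "a \<in> A" "b \<in> A" "H \<subseteq> carrier G"
  shows "\<exists>c\<in>A. c ` H = b ` a ` H"
proof
  show "compose (carrier G) b a \<in> A"
    using subgroup.m_closed[OF A assms(2,1)] aut_auto[OF assms(1)] aut_auto[OF assms(2)]
    by (simp add: AutoGroup_def BijGroup_def auto_def)
  show "compose (carrier G) b a ` H = b ` a ` H"
    using assms(3) by (force simp: compose_def image_iff)
qed

lemma aut_image_inverse:
  assumes "a \<in> A"
  shows "\<exists>b\<in>A. \<forall>H\<subseteq>carrier G. b ` a ` H = H"
proof -
  interpret AG: group "AutoGroup G" by (rule group.AutoGroup[OF grp])
  define b where "b = inv\<^bsub>AutoGroup G\<^esub> a"
  have b: "b \<in> A" unfolding b_def by (rule subgroup.m_inv_closed[OF A assms])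
  have "b \<otimes>\<^bsub>AutoGroup G\<^esub> a = \<one>\<^bsub>AutoGroup G\<^esub>"
    unfolding b_def using subgroup.mem_carrier[OF A assms] by simp
  then have "compose (carrier G) b a = (\<lambda>x\<in>carrier G. x)"
    using aut_auto[OF assms] aut_auto[OF b] by (simp add: AutoGroup_def BijGroup_def auto_def)
  then have "b (a x) = x" if "x \<in> carrier G" for x
    using that by (metis compose_eq restrict_apply')
  then show ?thesis using b by (force simp: subset_eq image_iff)
qed

lemma aut_class_eq_iff:
  assumes "H \<subseteq> carrier G" "K \<subseteq> carrier G"
  shows "aut_class A H = aut_class A K \<longleftrightarrow> (\<exists>a\<in>A. a ` H = K)"
proof
  assume "aut_class A H = aut_class A K"
  moreover have "K \<in> aut_class A K"
    using aut_image_id assms by (auto simp: aut_class_def intro!: exI[of _ "\<lambda>x\<in>carrier G. x"])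
  ultimately have "K \<in> aut_class A H" by simp
  then show "\<exists>a\<in>A. a ` H = K" by (auto simp: aut_class_def)
next
  assume "\<exists>a\<in>A. a ` H = K"
  then obtain a where a: "a \<in> A" "a ` H = K" by blast
  obtain b where b: "b \<in> A" "b ` K = H"
    using aut_image_inverse[OF a(1)] a(2) assms by blast
  have "aut_class A K \<subseteq> aut_class A H" if "a \<in> A" "a ` H = K" "H \<subseteq> carrier G" for a H K
  proof
    fix L assume "L \<in> aut_class A K"
    then obtain c where "c \<in> A" "L = c ` K" by (auto simp: aut_class_def)
    then show "L \<in> aut_class A H"
      using aut_image_compose[of a c H] that unfolding aut_class_def by blast
  qed
  from this[OF a assms(1)] this[OF b assms(2)] show "aut_class A H = aut_class A K" by blast
qed

lemma aut_class_order_iff: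
  assumes "subgroup H G" "subgroup K G"
  shows "(aut_class A H, aut_class A K) \<in> aut_class_order G A \<longleftrightarrow> (\<exists>a\<in>A. a ` H \<subseteq> K)"
proof
  assume "(aut_class A H, aut_class A K) \<in> aut_class_order G A"
  then obtain H' K' a where *: "aut_class A H = aut_class A H'" "aut_class A K' = aut_class A K"
    "subgroup H' G" "subgroup K' G" "a \<in> A" "a ` H' \<subseteq> K'"
    unfolding aut_class_order_def by auto
  note sub = assms[THEN subgroup.subset] *(3,4)[THEN subgroup.subset]
  obtain b c where b: "b \<in> A" "b ` H = H'" and c: "c \<in> A" "c ` K' = K"
    using * sub aut_class_eq_iff by metis
  obtain d where d: "d \<in> A" "d ` H = a ` b ` H"
    using aut_image_compose[OF b(1) *(5) sub(1)] by blast
  obtain e where e: "e \<in> A" "e ` H = c ` d ` H"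
    using aut_image_compose[OF d(1) c(1) sub(1)] by blast
  have "e ` H = c ` a ` H'" using e d b by simp
  then have "e ` H \<subseteq> K" using c *(6) by blast
  then show "\<exists>a\<in>A. a ` H \<subseteq> K" using e by blast
qed (use assms in \<open>auto simp: aut_class_order_def\<close>)

lemma finite_aut_classes: "finite (aut_classes G A)"
proof (rule finite_subset)
  show "aut_classes G A \<subseteq> aut_class A ` Pow (carrier G)"
    by (auto simp: aut_classes_def dest: subgroup.subset)
qed (simp add: fin)

lemma partial_order_aut_classes: "partial_order_on (aut_classes G A) (aut_class_order G A)"
  unfolding partial_order_on_def preorder_on_def
proof (intro conjI)
  show sub: "aut_class_order G A \<subseteq> aut_classes G A \<times> aut_classes G A"
    by (auto simp: aut_class_order_def aut_classes_def)
  show "refl_on (aut_classes G A) (aut_class_order G A)"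
  proof (rule refl_onI)
    fix S assume "S \<in> aut_classes G A"
    then obtain H where "S = aut_class A H" "subgroup H G" by (auto simp: aut_classes_def)
    then show "(S, S) \<in> aut_class_order G A"
      using aut_image_id subgroup.subset by (metis aut_class_order_iff order_refl)
  qed
  have elim: "\<exists>H K. S = aut_class A H \<and> T = aut_class A K \<and> subgroup H G \<and> subgroup K G"
    if "(S, T) \<in> aut_class_order G A" for S T
    using that by (auto simp: aut_class_order_def)
  show "trans (aut_class_order G A)"
  proof (rule transI)
    fix S T U assume le: "(S, T) \<in> aut_class_order G A" "(T, U) \<in> aut_class_order G A"
    obtain H K where H: "S = aut_class A H" "T = aut_class A K" "subgroup H G" "subgroup K G"
      using elim[OF le(1)] by blast
    obtain L where L: "U = aut_class A L" "subgroup L G" using elim[OF le(2)] by blast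
    obtain a b where ab: "a \<in> A" "b \<in> A" "a ` H \<subseteq> K" "b ` K \<subseteq> L"
      using le H L by (auto simp: aut_class_order_iff)
    obtain c where "c \<in> A" "c ` H = b ` a ` H"
      using aut_image_compose[OF ab(1,2) subgroup.subset[OF H(3)]] by blast
    then have "\<exists>c\<in>A. c ` H \<subseteq> L" using ab(3,4) by blast
    then show "(S, U) \<in> aut_class_order G A" using H L by (simp add: aut_class_order_iff)
  qed
  show "antisym (aut_class_order G A)"
  proof (rule antisymI)
    fix S T assume le: "(S, T) \<in> aut_class_order G A" "(T, S) \<in> aut_class_order G A"
    obtain H K where H: "S = aut_class A H" "T = aut_class A K" "subgroup H G" "subgroup K G"
      using elim[OF le(1)] by blast
    note sub = H(3,4)[THEN subgroup.subset]
    have finHK: "finite H" "finite K" using sub fin finite_subset by blast+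
    obtain a b where ab: "a \<in> A" "b \<in> A" "a ` H \<subseteq> K" "b ` K \<subseteq> H"
      using le H by (auto simp: aut_class_order_iff)
    have "card (b ` K) = card K"
      using aut_inj[OF ab(2)] sub(2) by (meson card_image inj_on_subset)
    moreover have "card (a ` H) = card H"
      using aut_inj[OF ab(1)] sub(1) by (meson card_image inj_on_subset)
    ultimately have "card K \<le> card (a ` H)" using card_mono[OF finHK(1) ab(4)] by simp
    then have "a ` H = K" by (rule card_seteq[OF finHK(2) ab(3)])
    then show "S = T" using aut_class_eq_iff[OF sub] ab(1) H by auto
  qed
qed

lemma is_moebius_aut_moebius:
  "is_moebius (aut_classes G A) (aut_class_order G A) (aut_moebius G A)"
  unfolding aut_moebius_def
  by (rule is_moebius_moebius[OF finite_aut_classes partial_order_aut_classes])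

end

end

theory Submission
  imports Defs
begin

text \<open>
  A tuple \<open>g\<close> lies in some \<open>(H\<^sup>a)\<^sup>t\<close> iff the class of the subgroup generated by \<open>g\<close> is at most
  \<open>[H]\<close>. Hence the size of the union attached to \<open>C\<close> is the sum over \<open>D \<le> C\<close> of the number of
  tuples that generate a member of \<open>D\<close>, and the formula is Moebius inversion at the top class,
  whose only member is \<open>G\<close>.
\<close>

text \<open>Since \<open>m x z\<close> vanishes unless \<open>(x, z) \<in> r\<close>, the defining
  sum over an interval extends to all of \<open>P\<close>. This is the matrix form of the
  definition: \<open>m\<close> times the incidence matrix of \<open>r\<close> is the
  identity.\<close>

lemma is_moebius_sum_lower:
  assumes fin: "finite P" and po: "partial_order_on P r" and m: "is_moebius P r m"
    and xy: "x \<in> P" "y \<in> P"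
  shows "(\<Sum>z\<in>P. m x z * of_bool ((z, y) \<in> r)) = of_bool (x = y)"
proof -
  have tr: "trans r" and anti: "antisym r" and refl: "(x, x) \<in> r"
    using po xy by (auto simp: partial_order_on_def preorder_on_def refl_on_def)
  have "(\<Sum>z\<in>P. m x z * of_bool ((z, y) \<in> r)) = (\<Sum>z\<in>{z\<in>P. (x, z) \<in> r \<and> (z, y) \<in> r}. m x z)"
    using m xy fin by (intro sum.mono_neutral_cong_right) (auto simp: is_moebius_def)
  also have "\<dots> = of_bool (x = y)"
  proof (cases "x = y")
    case True
    then have "{z\<in>P. (x, z) \<in> r \<and> (z, y) \<in> r} = {x}"
      using refl xy antisymD[OF anti] by auto
    then show ?thesis using True m xy by (simp add: is_moebius_def)
  next
    case False
    show ?thesis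
    proof (cases "(x, y) \<in> r")
      case True
      then show ?thesis using \<open>x \<noteq> y\<close> m xy by (simp add: is_moebius_def)
    next
      case False
      \<comment> \<open>The definition says nothing about a sum for incomparable \<open>x\<close>
        and \<open>y\<close>; here transitivity leaves no \<open>z\<close> between them.\<close>
      then have empty: "{z\<in>P. (x, z) \<in> r \<and> (z, y) \<in> r} = {}" using transD[OF tr] by blast
      show ?thesis unfolding empty using \<open>x \<noteq> y\<close> by simp
    qed
  qed
  finally show ?thesis .
qed

text \<open>
  Here \<open>m\<close> is a left inverse of the incidence matrix of \<open>r\<close>, and the Moebius function of the
  converse order, transposed, is a right inverse, so the two coincide.
\<close>

lemma is_moebius_transpose:
  assumes fin: "finite P" and po: "partial_order_on P r" and m: "is_moebius P r m"
    and n: "is_moebius P (r\<inverse>) n" and xy: "x \<in> P" "y \<in> P"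
  shows "m x y = n y x"
proof -
  have po': "partial_order_on P (r\<inverse>)" using po by simp
  have "m x y = (\<Sum>z\<in>P. m x z * of_bool (y = z))"
    using fin xy by (simp add: of_bool_def if_distrib cong: if_cong)
  also have "\<dots> = (\<Sum>z\<in>P. m x z * (\<Sum>w\<in>P. n y w * of_bool ((z, w) \<in> r)))"
    using is_moebius_sum_lower[OF fin po' n xy(2)] by (intro sum.cong) auto
  also have "\<dots> = (\<Sum>w\<in>P. n y w * (\<Sum>z\<in>P. m x z * of_bool ((z, w) \<in> r)))"
    by (simp only: sum_distrib_left, subst sum.swap) (simp only: mult.left_commute)
  also have "\<dots> = (\<Sum>w\<in>P. n y w * of_bool (x = w))"
    using is_moebius_sum_lower[OF fin po m xy(1)] by (intro sum.cong) auto
  also have "\<dots> = n y x"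
    using fin xy by (simp add: of_bool_def if_distrib cong: if_cong)
  finally show ?thesis .
qed

text \<open>Inversion needs the sum over the first argument, while \<open>is_moebius\<close> only
  controls sums over the second. Passing to the converse order swaps the two.\<close>

lemma is_moebius_sum_upper:
  assumes fin: "finite P" and po: "partial_order_on P r" and m: "is_moebius P r m"
    and xy: "x \<in> P" "y \<in> P"
  shows "(\<Sum>z\<in>P. m z y * of_bool ((x, z) \<in> r)) = of_bool (x = y)"
proof -
  have po': "partial_order_on P (r\<inverse>)" using po by simp
  obtain n where n: "is_moebius P (r\<inverse>) n" using is_moebius_exists[OF fin po'] by blast
  have "(\<Sum>z\<in>P. m z y * of_bool ((x, z) \<in> r)) = (\<Sum>z\<in>P. n y z * of_bool ((z, x) \<in> r\<inverse>))"
    using is_moebius_transpose[OF fin po m n _ xy(2)] by (intro sum.cong) auto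
  then show ?thesis using is_moebius_sum_lower[OF fin po' n xy(2,1)] by auto
qed

text \<open>After exchanging the sums, the coefficient of \<open>f x\<close> is the upper sum of
  \<open>m\<close> from \<open>x\<close> to \<open>y\<close>, which is 1 for \<open>x = y\<close>
  and 0 otherwise.\<close>

theorem moebius_inversion:
  fixes f g :: "'a \<Rightarrow> int"
  assumes fin: "finite P" and po: "partial_order_on P r" and m: "is_moebius P r m"
    and y: "y \<in> P" and g: "\<And>z. z \<in> P \<Longrightarrow> g z = (\<Sum>x\<in>{x\<in>P. (x, z) \<in> r}. f x)"
  shows "(\<Sum>z\<in>P. m z y * g z) = f y"
proof -
  have "(\<Sum>z\<in>P. m z y * g z) = (\<Sum>z\<in>P. \<Sum>x\<in>P. f x * (m z y * of_bool ((x, z) \<in> r)))"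
  proof (rule sum.cong)
    fix z assume "z \<in> P"
    then have "g z = (\<Sum>x\<in>P. f x * of_bool ((x, z) \<in> r))"
      using g fin by (auto intro!: sum.mono_neutral_cong_left)
    then show "m z y * g z = (\<Sum>x\<in>P. f x * (m z y * of_bool ((x, z) \<in> r)))"
      by (simp only: sum_distrib_left mult.left_commute)
  qed simp
  also have "\<dots> = (\<Sum>x\<in>P. f x * (\<Sum>z\<in>P. m z y * of_bool ((x, z) \<in> r)))"
    by (subst sum.swap) (simp only: sum_distrib_left)
  also have "\<dots> = (\<Sum>x\<in>P. f x * of_bool (x = y))"
    using is_moebius_sum_upper[OF fin po m _ y] by (intro sum.cong) auto
  also have "\<dots> = f y"
    using fin y by (simp add: of_bool_def if_distrib cong: if_cong)
  finally show ?thesis .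
qed

lemma (in group) subgroup_auto_image:
  assumes "a \<in> auto G" "subgroup H G"
  shows "subgroup (a ` H) G"
proof -
  have "group_hom G G a"
    using assms(1) by (auto simp: auto_def group_hom_def group_hom_axioms_def)
  then show ?thesis using assms(2) by (rule group_hom.subgroup_img_is_subgroup)
qed

lemma tuples_mem_iff: "g \<in> tuples t S \<longleftrightarrow> g \<in> extensional {1..t} \<and> g ` {1..t} \<subseteq> S"
  by (auto simp: tuples_def PiE_def)

context
  fixes G :: "('a, 'b) monoid_scheme" (structure) and A
  assumes grp: "group G" and fin: "finite (carrier G)" and A: "subgroup A (AutoGroup G)"
begin

interpretation group G by (rule grp)

lemma Union_tuples_iff_generate:
  assumes K: "subgroup K G" and g: "g \<in> tuples t (carrier G)"
  shows "g \<in> (\<Union>L\<in>aut_class A K. tuples t L) \<longleftrightarrow>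
    (aut_class A (generate G (g ` {1..t})), aut_class A K) \<in> aut_class_order G A"
proof -
  let ?H = "generate G (g ` {1..t})"
  have sub: "g ` {1..t} \<subseteq> carrier G" and ext: "g \<in> extensional {1..t}"
    using g by (auto simp: tuples_mem_iff)
  have H: "subgroup ?H G" using sub by (rule generate_is_subgroup)
  note HK = subgroup.subset[OF H] subgroup.subset[OF K]
  have mem: "g \<in> tuples t (a ` K) \<longleftrightarrow> ?H \<subseteq> a ` K" if "a \<in> A" for a
  proof -
    have "subgroup (a ` K) G"
      using aut_auto[OF grp fin A that] K by (rule subgroup_auto_image)
    \<comment> \<open>A subgroup contains the entries of \<open>g\<close> exactly when it contains
      the subgroup that they generate.\<close>
    then have "g ` {1..t} \<subseteq> a ` K \<longleftrightarrow> ?H \<subseteq> a ` K"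
      by (meson generate_subgroup_incl generate.incl subset_iff)
    then show ?thesis using ext by (simp add: tuples_mem_iff)
  qed
  \<comment> \<open>The union moves the larger subgroup, whereas the order moves the smaller one;
    the inverse automorphism translates between the two.\<close>
  have "(\<exists>a\<in>A. ?H \<subseteq> a ` K) \<longleftrightarrow> (\<exists>a\<in>A. a ` ?H \<subseteq> K)"
  proof
    assume "\<exists>a\<in>A. ?H \<subseteq> a ` K"
    then obtain a where a: "a \<in> A" "?H \<subseteq> a ` K" ..
    obtain b where b: "b \<in> A" "\<forall>H\<subseteq>carrier G. b ` a ` H = H"
      using aut_image_inverse[OF grp fin A a(1)] ..
    have "b ` ?H \<subseteq> K" using image_mono[OF a(2), of b] b(2) HK(2) by simp
    then show "\<exists>a\<in>A. a ` ?H \<subseteq> K" using b(1) ..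
  next
    assume "\<exists>a\<in>A. a ` ?H \<subseteq> K"
    then obtain a where a: "a \<in> A" "a ` ?H \<subseteq> K" ..
    obtain b where b: "b \<in> A" "\<forall>H\<subseteq>carrier G. b ` a ` H = H"
      using aut_image_inverse[OF grp fin A a(1)] ..
    have "?H \<subseteq> b ` K" using image_mono[OF a(2), of b] b(2) HK(1) by simp
    then show "\<exists>a\<in>A. ?H \<subseteq> a ` K" using b(1) ..
  qed
  then show ?thesis
    unfolding Union_tuples_aut_class aut_class_order_iff[OF grp fin A H K] using mem by simp
qed

text \<open>The tuples in the union are sorted by the class of the subgroup that they generate.
  These fibres are disjoint, and \<open>Union_tuples_iff_generate\<close> tells which of them lie in
  the union.\<close>

lemma card_Union_tuples:
  assumes C: "C \<in> aut_classes G A"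
  shows "card (\<Union>K\<in>C. tuples t K) =
    (\<Sum>D\<in>{D\<in>aut_classes G A. (D, C) \<in> aut_class_order G A}.
       card {g \<in> tuples t (carrier G). aut_class A (generate G (g ` {1..t})) = D})"
    (is "_ = (\<Sum>D\<in>?I. card (?F D))")
proof -
  obtain K where K: "subgroup K G" "C = aut_class A K" using C by (auto simp: aut_classes_def)
  have "L \<subseteq> carrier G" if "L \<in> C" for L
    using that subgroup.subset[OF K(1)] aut_image_carrier[OF grp fin A]
    unfolding K(2) aut_class_def by blast
  then have carrier: "g \<in> tuples t (carrier G)" if "g \<in> (\<Union>L\<in>C. tuples t L)" for g
    using that unfolding UN_iff tuples_mem_iff by (meson order_trans)
  have class_mem: "aut_class A (generate G (g ` {1..t})) \<in> aut_classes G A"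
    if "g \<in> tuples t (carrier G)" for g
    using that generate_is_subgroup by (auto simp: aut_classes_def tuples_mem_iff)
  have union: "(\<Union>L\<in>C. tuples t L) = (\<Union>D\<in>?I. ?F D)"
  proof (rule Set.set_eqI)
    fix g
    have "g \<in> (\<Union>D\<in>?I. ?F D) \<longleftrightarrow> g \<in> tuples t (carrier G) \<and>
        (aut_class A (generate G (g ` {1..t})), C) \<in> aut_class_order G A"
      using class_mem[of g] by auto
    then show "g \<in> (\<Union>L\<in>C. tuples t L) \<longleftrightarrow> g \<in> (\<Union>D\<in>?I. ?F D)"
      using carrier[of g] Union_tuples_iff_generate[OF K(1), of g t] unfolding K(2) by argo
  qed
  have "finite (tuples t (carrier G))"
    unfolding tuples_def using fin by (intro finite_PiE) auto
  then show ?thesis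
    unfolding union using finite_aut_classes[OF grp fin A] by (intro card_UN_disjoint) auto
qed

text \<open>Every automorphism maps \<open>carrier G\<close> onto itself, so the top class has no
  other member.\<close>

lemma aut_class_eq_top_iff:
  assumes "H \<subseteq> carrier G"
  shows "aut_class A H = aut_class A (carrier G) \<longleftrightarrow> H = carrier G"
  using aut_class_eq_iff[OF grp fin A subset_refl assms] aut_image_carrier[OF grp fin A]
    aut_image_id(1)[OF grp fin A] by blast

end

theorem theorem2:
  fixes G :: "('a, 'b) monoid_scheme" and A :: "('a \<Rightarrow> 'a) set" and t :: nat
  assumes "group G" and "finite (carrier G)"
    and "subgroup A (AutoGroup G)"
    and "0 < t"
  shows "int (num_generating_tuples G t) =
    (\<Sum>C\<in>aut_classes G A.
       aut_moebius G A C (aut_class A (carrier G)) * int (card (\<Union>K\<in>C. tuples t K)))"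
proof -
  interpret group G by (rule assms(1))
  note GA = assms(1-3)
  \<comment> \<open>The function to be recovered by inversion: its value at the top class is the
    number of generating tuples.\<close>
  define f where
    "f D = int (card {g \<in> tuples t (carrier G). aut_class A (generate G (g ` {1..t})) = D})" for D
  have "generate G (g ` {1..t}) \<subseteq> carrier G" if "g \<in> tuples t (carrier G)" for g
    using that generate_incl by (auto simp: tuples_mem_iff)
  then have "int (num_generating_tuples G t) = f (aut_class A (carrier G))"
    unfolding num_generating_tuples_def f_def
    using aut_class_eq_top_iff[OF GA] by (simp cong: conj_cong)
  also have "\<dots> = (\<Sum>C\<in>aut_classes G A.
      aut_moebius G A C (aut_class A (carrier G)) * int (card (\<Union>K\<in>C. tuples t K)))"
  proof (rule moebius_inversion[symmetric, OF finite_aut_classes[OF GA]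
        partial_order_aut_classes[OF GA] is_moebius_aut_moebius[OF GA]])
    show "aut_class A (carrier G) \<in> aut_classes G A"
      using subgroup_self by (auto simp: aut_classes_def)
    show "int (card (\<Union>K\<in>C. tuples t K)) =
        (\<Sum>D\<in>{D\<in>aut_classes G A. (D, C) \<in> aut_class_order G A}. f D)"
      if "C \<in> aut_classes G A" for C
      using card_Union_tuples[OF GA that] by (simp add: f_def)
  qed
  finally show ?thesis .
qed

end
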